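(* Let $t\geq 6$ be an integer and suppose that every $PG(t-2,2)$-free matroid $M'$ with $|M'|>(1-3\cdot 2^{-(t-1)})2^{r(M')}$ satisfies $\chi(M')\in\{t-2,t-1\}$. Then there is no $PG(t-1,2)$-free matroid $M$ with $|M|>(1-3\cdot 2^{-t})2^{r(M)}$ and $\chi(M)>t$.
   Context: A matroid $M$ means a simple binary matroid, represented by an integer $r(M)\geq 0$ (its rank) and a set $E(M)\subseteq \mathbb{F}_2^{r(M)}\setminus\{0\}$ that spans $\mathbb{F}_2^{r(M)}$; $|M|:=|E(M)|$. The critical number $\chi(M)$ is the smallest $k$ such that some subspace of $\mathbb{F}_2^{r(M)}$ of codimension $k$ is disjoint from $E(M)$. A matroid $M$ contains a matroid $N$ if there is an injective linear map $\iota:\mathbb{F}_2^{r(N)}\to\mathbb{F}_2^{r(M)}$ with $\iota(E(N))\subseteq E(M)$; $M$ is $N$-free if it does not contain $N$. The projective geometry $PG(s-1,2)$ is the matroid of rank $s$ with edge set $\mathbb{F}_2^s\setminus\{0\}$. *)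

theory Defs
  imports Complex_Main "HOL-Library.Z2" "HOL-Library.Function_Algebras"
begin

text \<open>
  Ranks vary inside the statement, so all spaces $F_2^r$ live in the one ambient
  vector space of sequences over the two-element field \<^typ>\<open>bit\<close>: $F_2^r$ consists of the
  sequences vanishing from index $r$ on.
\<close>

definition scale2 :: "bit \<Rightarrow> (nat \<Rightarrow> bit) \<Rightarrow> (nat \<Rightarrow> bit)" where
  "scale2 c v = (\<lambda>i. c * v i)"

interpretation V2: vector_space scale2
  by unfold_locales
    (simp_all only: scale2_def plus_fun_def distrib_left distrib_right mult.assoc mult_1)

definition F2 :: "nat \<Rightarrow> (nat \<Rightarrow> bit) set" where
  "F2 r = {v. \<forall>i\<ge>r. v i = 0}"

record matroid =
  rk :: nat
  elts :: "(nat \<Rightarrow> bit) set"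

text \<open>Simple binary matroids, in a given representation.\<close>

definition simple_binary_matroid :: "matroid \<Rightarrow> bool" where
  "simple_binary_matroid M \<longleftrightarrow>
     elts M \<subseteq> F2 (rk M) - {0} \<and> V2.span (elts M) = F2 (rk M)"

text \<open>The subspace $W$ has codimension $k$ in $F_2^{r(M)}$ when its dimension plus $k$ is $r(M)$.
  The zero subspace is always disjoint from the ground set, so the minimum exists.\<close>

definition critical_number :: "matroid \<Rightarrow> nat" where
  "critical_number M =
     (LEAST k. \<exists>W. V2.subspace W \<and> W \<subseteq> F2 (rk M) \<and> V2.dim W + k = rk M
                   \<and> W \<inter> elts M = {})"

text \<open>Only the values of $f$ on $F_2^m$ matter.\<close>

definition linear_F2 :: "nat \<Rightarrow> nat \<Rightarrow> ((nat \<Rightarrow> bit) \<Rightarrow> (nat \<Rightarrow> bit)) \<Rightarrow> bool" where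
  "linear_F2 m n f \<longleftrightarrow> f ` F2 m \<subseteq> F2 n
     \<and> (\<forall>x\<in>F2 m. \<forall>y\<in>F2 m. f (x + y) = f x + f y)
     \<and> (\<forall>c. \<forall>x\<in>F2 m. f (scale2 c x) = scale2 c (f x))"

definition contains :: "matroid \<Rightarrow> matroid \<Rightarrow> bool" where
  "contains M N \<longleftrightarrow>
     (\<exists>f. linear_F2 (rk N) (rk M) f \<and> inj_on f (F2 (rk N)) \<and> f ` elts N \<subseteq> elts M)"

abbreviation free_of :: "matroid \<Rightarrow> matroid \<Rightarrow> bool" where
  "free_of N M \<equiv> \<not> contains M N"

text \<open>Indexed by rank rather than projective dimension: \<open>proj_geom s\<close> is $PG(s-1,2)$.\<close>

definition proj_geom :: "nat \<Rightarrow> matroid" where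
  "proj_geom s = \<lparr>rk = s, elts = F2 s - {0}\<rparr>"

end

theory Submission
  imports Defs
begin

text \<open>
  Let \<open>n = d + t\<close> be the rank of a counterexample and \<open>C\<close> the complement of its ground set \<open>E\<close>
  in \<open>F\<^sub>2\<^sup>n\<close>. Then \<open>|C| < 3 D\<close> with \<open>D = 2^d\<close>, every subspace of dimension \<open>t\<close> meets \<open>C - {0}\<close>,
  and \<open>C\<close> contains no subspace of dimension \<open>d\<close>. The hypothesis enters twice. Applied to
  \<open>C \<inter> H\<close> it yields \<open>|C - H| \<ge> D\<close> for all hyperplanes \<open>H\<close>, and averaging over the hyperplanes
  through a proper subspace \<open>Z\<close> gives \<open>|C \<inter> Z| < D + 2 |Z| / 2^t\<close>. Applied to the projection
  of \<open>C\<close> from a point \<open>x \<in> E\<close> it yields a subspace \<open>U x\<close> of dimension \<open>d + 1\<close> containing \<open>x\<close>, each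
  of whose cosets of \<open>{0, x}\<close> meets \<open>C\<close>; in particular \<open>|C \<inter> U x| \<ge> D\<close>.

  By the bound applied to \<open>U x + U y\<close>, distinct \<open>U x\<close> and \<open>U y\<close> which share more than \<open>D / 8\<close>
  points of \<open>C\<close> meet in dimension \<open>d\<close> and share more than \<open>7 D / 8\<close> points of \<open>C\<close>. As
  \<open>4 D - 6 D / 8 > 3 D\<close>, no four of the \<open>U x\<close> pairwise share at most \<open>D / 8\<close> points of \<open>C\<close>. The
  \<open>U x\<close> sharing more than that with a given \<open>U y\<close>, where \<open>x \<notin> U y\<close>, all meet it in the same
  subspace \<open>K\<close>, since \<open>|C \<inter> U y| \<le> 17 D / 16\<close>. There is some \<open>k \<in> K - C\<close>, and then \<open>x \<in> k + C\<close> for all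
  these \<open>x\<close>. Hence three choices of \<open>y\<close> account for fewer than \<open>3 (2 D + 3 D)\<close> points of \<open>E\<close>, whereas
  \<open>|E| > 61 D\<close>.
\<close>

section \<open>Finite subspaces over the two-element field\<close>

lemma bit_self_add: "(a::bit) + a = 0"
  by (cases a) simp_all

lemma vec_self_add: "(x::nat \<Rightarrow> bit) + x = 0"
  by (rule ext) (simp only: plus_fun_def zero_fun_def bit_self_add)

lemma vec_add_cancel: "(x::nat \<Rightarrow> bit) + y + y = x"
  by (simp only: add.assoc vec_self_add add_0_right)

lemma subspace_iff:
  "V2.subspace S \<longleftrightarrow> 0 \<in> S \<and> (\<forall>x\<in>S. \<forall>y\<in>S. x + y \<in> S)"
proof -
  have "scale2 c x \<in> S" if "0 \<in> S" "x \<in> S" for c x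
    using that by (cases c) simp_all
  then show ?thesis
    by (auto simp: V2.subspace_def)
qed

section \<open>Cardinalities and coordinates of subspaces\<close>

lemma F2_Suc: "F2 (Suc k) = F2 k \<union> (\<lambda>v. v(k := 1)) ` F2 k"
proof (intro set_eqI iffI)
  fix v assume v: "v \<in> F2 (Suc k)"
  show "v \<in> F2 k \<union> (\<lambda>v. v(k := 1)) ` F2 k"
  proof (cases "v k = 0")
    case True
    then have "v \<in> F2 k"
      using v by (auto simp: F2_def) (metis Suc_leI le_neq_implies_less)
    then show ?thesis by simp
  next
    case False
    then have "v = (v(k := 0))(k := 1)" by auto
    moreover have "v(k := 0) \<in> F2 k"
      using v by (auto simp: F2_def)
    ultimately show ?thesis by blast
  qed
qed (auto simp: F2_def)

lemma finite_card_F2: "finite (F2 k) \<and> card (F2 k) = 2 ^ k"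
proof (induction k)
  case 0
  have "F2 0 = {\<lambda>_. 0}" by (auto simp: F2_def)
  then show ?case by simp
next
  case (Suc k)
  have inj: "inj_on (\<lambda>v. v(k := 1::bit)) (F2 k)"
  proof (rule inj_onI)
    fix u v :: "nat \<Rightarrow> bit"
    assume u: "u \<in> F2 k" and v: "v \<in> F2 k" and eq: "u(k := 1) = v(k := 1)"
    show "u = v"
    proof
      fix i show "u i = v i"
        using u v fun_cong[OF eq, of i] by (cases "i = k") (auto simp: F2_def)
    qed
  qed
  have "F2 k \<inter> (\<lambda>v. v(k := 1)) ` F2 k = {}"
    by (auto simp: F2_def)
  then show ?case
    using Suc inj by (simp add: F2_Suc card_Un_disjoint card_image)
qed

lemmas finite_F2 [simp] = finite_card_F2[THEN conjunct1]
  and card_F2 [simp] = finite_card_F2[THEN conjunct2]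

lemma subspace_F2: "V2.subspace (F2 k)"
  by (auto simp: subspace_iff F2_def plus_fun_def zero_fun_def simp del: add_bit_eq_xor)

text \<open>Coordinates with respect to a basis. The map reads only the first
  \<open>V2.dim S\<close> entries, so it is defined and additive on all sequences, and subspaces of
  the coordinate space move into \<open>S\<close> without side conditions.\<close>

lemma subspace_parametrization:
  assumes S: "V2.subspace S" "finite S"
  obtains f :: "(nat \<Rightarrow> bit) \<Rightarrow> (nat \<Rightarrow> bit)"
    where "\<And>x y. f (x + y) = f x + f y" "inj_on f (F2 (V2.dim S))" "f ` F2 (V2.dim S) = S"
proof -
  obtain B where B: "B \<subseteq> S" "V2.independent B" "S \<subseteq> V2.span B" "card B = V2.dim S"
    using V2.basis_exists by blast
  have finB: "finite B" using B S finite_subset by blast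
  have span: "V2.span B = S"
    using B S by (simp add: V2.span_minimal subset_antisym)
  define k where "k = V2.dim S"
  obtain b where b: "bij_betw b {..<k} B"
    using finB B(4) ex_bij_betw_nat_finite[of B] by (auto simp: k_def atLeast0LessThan)
  define f where "f v = (\<Sum>i<k. scale2 (v i) (b i))" for v
  have add: "f (x + y) = f x + f y" for x y
    by (simp only: f_def plus_fun_def[of x y] V2.scale_left_distrib sum.distrib)
  have f_reindex: "f v = (\<Sum>w\<in>B. scale2 (v (the_inv_into {..<k} b w)) w)" for v
  proof -
    have "f v = (\<Sum>i<k. scale2 (v (the_inv_into {..<k} b (b i))) (b i))"
      unfolding f_def using b
      by (intro sum.cong) (auto simp: bij_betw_def the_inv_into_f_f)
    also have "\<dots> = (\<Sum>w\<in>B. scale2 (v (the_inv_into {..<k} b w)) w)"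
      by (rule sum.reindex_bij_betw[OF b])
    finally show ?thesis .
  qed
  have ker: "v = 0" if v: "v \<in> F2 k" "f v = 0" for v
  proof
    fix i
    show "v i = 0 i"
    proof (cases "i < k")
      case True
      then have bi: "b i \<in> B" using b by (auto simp: bij_betw_def)
      have "v (the_inv_into {..<k} b (b i)) = 0"
        by (rule V2.independentD[OF B(2) finB order.refl _ bi]) (use v f_reindex in simp)
      then show ?thesis
        using True b by (simp add: bij_betw_def the_inv_into_f_f)
    qed (use v in \<open>simp add: F2_def\<close>)
  qed
  have "inj_on f (F2 k)"
  proof (rule inj_onI)
    fix u v assume uv: "u \<in> F2 k" "v \<in> F2 k" "f u = f v"
    have "u + v \<in> F2 k"
      using uv subspace_F2 V2.subspace_add by blast
    moreover have "f (u + v) = 0"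
      by (simp only: add uv(3) vec_self_add)
    ultimately have "u + v = 0"
      by (rule ker)
    then show "u = v"
      using vec_add_cancel[of u v] by (simp only: add_0_left)
  qed
  moreover have "f ` F2 k = S"
  proof
    show "f ` F2 k \<subseteq> S"
      using b B(1) S(1) unfolding f_def
      by (auto intro!: V2.subspace_sum V2.subspace_scale simp: bij_betw_def)
    show "S \<subseteq> f ` F2 k"
    proof
      fix s assume "s \<in> S"
      then obtain u where u: "s = (\<Sum>w\<in>B. scale2 (u w) w)"
        using span V2.span_finite[OF finB] by auto
      define v where "v i = (if i < k then u (b i) else 0)" for i
      have "s = f v"
        using sum.reindex_bij_betw[OF b, of "\<lambda>w. scale2 (u w) w"]
        by (simp add: u f_def v_def)
      then show "s \<in> f ` F2 k"
        by (auto simp: F2_def v_def)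
    qed
  qed
  ultimately show thesis
    using that[of f, OF add] by (simp add: k_def)
qed

lemma card_subspace:
  assumes "V2.subspace S" "finite S"
  shows "card S = 2 ^ V2.dim S"
  using subspace_parametrization[OF assms] by (metis card_F2 card_image)

lemma dim_eq_iff_card:
  assumes "V2.subspace S" "finite S"
  shows "V2.dim S = k \<longleftrightarrow> card S = 2 ^ k"
  by (simp add: card_subspace[OF assms])

lemma additive_image_subspace:
  assumes "\<And>x y. x \<in> S \<Longrightarrow> y \<in> S \<Longrightarrow> f (x + y) = f x + f y" "V2.subspace S"
  shows "V2.subspace (f ` S)"
proof -
  have "f 0 = f 0 + f 0"
    using assms(1)[of 0 0] assms(2) by (simp add: subspace_iff)
  then have "f 0 = 0" by (simp only: vec_self_add)
  then have "0 \<in> f ` S"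
    using assms(2) V2.subspace_0 by (metis image_eqI)
  moreover have "f x + f y \<in> f ` S" if "x \<in> S" "y \<in> S" for x y
    using that assms(2) by (simp add: V2.subspace_add flip: assms(1))
  ultimately show ?thesis
    by (auto simp: subspace_iff)
qed

lemma F2_mono: "j \<le> k \<Longrightarrow> F2 j \<subseteq> F2 k"
  by (auto simp: F2_def)

lemma subspace_of_card:
  assumes "V2.subspace S" "finite S" "card S = 2 ^ k" "j \<le> k"
  obtains T where "V2.subspace T" "T \<subseteq> S" "card T = 2 ^ j"
proof -
  have k: "V2.dim S = k" using dim_eq_iff_card assms by blast
  obtain f :: "(nat \<Rightarrow> bit) \<Rightarrow> (nat \<Rightarrow> bit)" where f: "\<And>x y. f (x + y) = f x + f y" "inj_on f (F2 k)" "f ` F2 k = S"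
    using subspace_parametrization[OF assms(1,2)] k by blast
  show thesis
  proof
    show "V2.subspace (f ` F2 j)"
      using f(1) subspace_F2 by (rule additive_image_subspace)
    show "f ` F2 j \<subseteq> S" using f(3) F2_mono[OF assms(4)] by blast
    show "card (f ` F2 j) = 2 ^ j"
      using inj_on_subset[OF f(2) F2_mono[OF assms(4)]] by (simp add: card_image)
  qed
qed

lemma card_psubset_subspace:
  assumes "V2.subspace S" "V2.subspace T" "finite T" "S \<subset> T"
  shows "2 * card S \<le> card T"
proof -
  have "finite S" using assms finite_subset by blast
  then have "card S = 2 ^ V2.dim S" "card T = 2 ^ V2.dim T"
    using assms card_subspace by auto
  moreover have "card S < card T" using assms by (simp add: psubset_card_mono)
  ultimately have "Suc (V2.dim S) \<le> V2.dim T" by simp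
  then have "(2::nat) ^ Suc (V2.dim S) \<le> 2 ^ V2.dim T"
    by (intro power_increasing) auto
  then show ?thesis
    using \<open>card S = _\<close> \<open>card T = _\<close> by simp
qed

text \<open>One half of the dimension formula, enough for upper bounds on sums. Fixing a splitting
  \<open>z = p z + (p z + z)\<close> of each sum and shifting both parts by \<open>k\<close> in
  \<open>S \<inter> T\<close> embeds the pairs \<open>(z, k)\<close> in
  \<open>S \<times> T\<close>.\<close>

lemma card_sums_Int:
  assumes S: "V2.subspace S" "finite S" and T: "V2.subspace T" "finite T"
  shows "card {x + y |x y. x \<in> S \<and> y \<in> T} * card (S \<inter> T) \<le> card S * card T"
proof -
  define Z where "Z = {x + y |x y. x \<in> S \<and> y \<in> T}"
  obtain p where p: "\<And>z. z \<in> Z \<Longrightarrow> p z \<in> S" "\<And>z. z \<in> Z \<Longrightarrow> p z + z \<in> T"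
  proof -
    have "\<forall>z\<in>Z. \<exists>x. x \<in> S \<and> x + z \<in> T"
      unfolding Z_def by (auto simp: vec_self_add simp flip: add.assoc)
    then show thesis using that by metis
  qed
  define h where "h = (\<lambda>(z, k). (p z + k, p z + z + k))"
  have "inj_on h (Z \<times> (S \<inter> T))"
  proof (rule inj_onI, clarify)
    fix z k z' k'
    assume "h (z, k) = h (z', k')"
    then have eq: "p z + k = p z' + k'" "p z + z + k = p z' + z' + k'"
      by (auto simp: h_def)
    have "(p z + k) + (p z + z + k) = z + (p z + p z) + (k + k)" for z k
      by (simp only: add.assoc add.commute add.left_commute)
    then have "z = (p z + k) + (p z + z + k)" for z k
      by (simp only: vec_self_add add_0_right)
    then have "z = z'" using eq by metis
    then show "z = z' \<and> k = k'" using eq by simp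
  qed
  moreover have "h ` (Z \<times> (S \<inter> T)) \<subseteq> S \<times> T"
    using p S T by (auto simp: h_def subspace_iff)
  ultimately have "card (Z \<times> (S \<inter> T)) \<le> card (S \<times> T)"
    using S T by (intro card_inj_on_le[of h]) auto
  then show ?thesis
    by (simp add: Z_def card_cartesian_product)
qed

lemma adjoin_subspace:
  assumes T: "V2.subspace T" "finite T" and x: "x \<notin> T"
  shows "V2.subspace (T \<union> (+) x ` T)" and "card (T \<union> (+) x ` T) = 2 * card T"
proof -
  have sum: "(x + a) + (x + b) = a + b" for a b
  proof -
    have "(x + a) + (x + b) = (x + x) + (a + b)"
      by (simp only: add.assoc add.commute add.left_commute)
    then show ?thesis by (simp only: vec_self_add add_0_left)
  qed
  have "0 \<in> T" and cl: "\<And>a b. a \<in> T \<Longrightarrow> b \<in> T \<Longrightarrow> a + b \<in> T"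
    using T by (auto simp: subspace_iff)
  show "V2.subspace (T \<union> (+) x ` T)"
    unfolding subspace_iff
  proof (intro conjI ballI)
    show "0 \<in> T \<union> (+) x ` T" using \<open>0 \<in> T\<close> by blast
    fix a b assume "a \<in> T \<union> (+) x ` T" "b \<in> T \<union> (+) x ` T"
    then obtain a' b' where ab: "a' \<in> T" "b' \<in> T" "a = a' \<or> a = x + a'" "b = b' \<or> b = x + b'"
      by blast
    have "a + b = a' + b' \<or> a + b = x + (a' + b')"
      using ab(3,4) sum[of a' b'] by (metis add.assoc add.left_commute)
    then show "a + b \<in> T \<union> (+) x ` T" using cl[OF ab(1,2)] by (elim disjE) simp_all
  qed
  have "T \<inter> (+) x ` T = {}"
  proof -
    have "x + a \<notin> T" if "a \<in> T" for a
      using cl[of "x + a" a] that x by (metis vec_add_cancel)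
    then show ?thesis by blast
  qed
  then show "card (T \<union> (+) x ` T) = 2 * card T"
    using T by (simp add: card_Un_disjoint card_image)
qed

text \<open>The points of \<open>V\<close> outside the kernel form its translate by
  \<open>b\<close>.\<close>

lemma kernel_card:
  fixes g :: "(nat \<Rightarrow> bit) \<Rightarrow> bit"
  assumes V: "V2.subspace V" "finite V"
    and g: "\<And>x y. x \<in> V \<Longrightarrow> y \<in> V \<Longrightarrow> g (x + y) = g x + g y"
    and b: "b \<in> V" "g b = 1"
  shows "V2.subspace {v \<in> V. g v = 0}" and "2 * card {v \<in> V. g v = 0} = card V"
proof -
  let ?H = "{v \<in> V. g v = 0}"
  have V0: "0 \<in> V" and cl: "\<And>a b. a \<in> V \<Longrightarrow> b \<in> V \<Longrightarrow> a + b \<in> V"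
    using V by (auto simp: subspace_iff)
  have g0: "g 0 = 0"
    using g[OF V0 V0] by (simp only: bit_self_add add_0_right)
  show H: "V2.subspace ?H"
    unfolding subspace_iff
  proof (intro conjI ballI)
    show "0 \<in> ?H" using V0 g0 by blast
    fix a b assume ab: "a \<in> ?H" "b \<in> ?H"
    then have "g (a + b) = 0 + 0" using g[of a b] by (simp only: mem_Collect_eq)
    then show "a + b \<in> ?H" using ab cl by (simp only: mem_Collect_eq add_0_left)
  qed
  have bH: "b \<notin> ?H" using b by simp
  have "V \<subseteq> ?H \<union> (+) b ` ?H"
  proof
    fix v assume v: "v \<in> V"
    show "v \<in> ?H \<union> (+) b ` ?H"
    proof (cases "g v = 0")
      case False
      then have "g v = 1" by simp
      then have "g (v + b) = 0" using g[OF v b(1)] b(2) by (simp only: bit_self_add)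
      moreover have "v = b + (v + b)"
        using vec_add_cancel[of v b] by (simp only: add.commute)
      ultimately show ?thesis using cl[OF v b(1)] by blast
    qed (use v in simp)
  qed
  then have "V = ?H \<union> (+) b ` ?H"
    using b(1) cl by auto
  then show "2 * card ?H = card V"
    using adjoin_subspace(2)[OF H _ bH] V(2) by simp
qed

section \<open>Parity and inclusion-exclusion counts\<close>

lemma card_odd_sums:
  fixes r :: "'a \<Rightarrow> bit"
  assumes "finite A"
  shows "2 * card {I \<in> Pow A. sum r I = 1} \<le> 2 ^ card A"
proof (cases "\<exists>a\<in>A. r a = 1")
  case False
  then have "sum r I = 0" if "I \<subseteq> A" for I
    using that by (intro sum.neutral) auto
  then have "sum r I \<noteq> 1" if "I \<in> Pow A" for I
    using that by (metis PowD zero_neq_one)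
  then have "{I \<in> Pow A. sum r I = 1} = {}" by blast
  then have "card {I \<in> Pow A. sum r I = 1} = 0" by (simp only: card.empty)
  then show ?thesis by (simp only: mult_0_right zero_le)
next
  case True
  then obtain a where a: "a \<in> A" "r a = 1" by blast
  \<comment> \<open>Toggling \<open>a\<close> flips the parity of the sum, so the sets of odd sum
    are mapped injectively to sets of even sum.\<close>
  define toggle where "toggle I = (if a \<in> I then I - {a} else insert a I)" for I
  let ?X = "{I \<in> Pow A. sum r I = 1}"
  have toggle2: "toggle (toggle I) = I" for I by (auto simp: toggle_def)
  have "sum r (toggle I) = 0" if "I \<in> ?X" for I
  proof -
    have fin: "finite I" using that assms finite_subset by blast
    show ?thesis
    proof (cases "a \<in> I")
      case True
      have "sum r I = r a + sum r (I - {a})"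
        using fin True by (rule sum.remove)
      then have "1 = 1 + sum r (I - {a})" using that a by (simp only: mem_Collect_eq)
      then show ?thesis using True by (cases "sum r (I - {a})") (simp_all add: toggle_def)
    next
      case False
      then have "sum r (insert a I) = r a + sum r I"
        using fin by (rule sum.insert[rotated])
      then show ?thesis using that a False by (simp add: toggle_def)
    qed
  qed
  then have "?X \<inter> toggle ` ?X = {}" by auto
  moreover have "inj_on toggle ?X"
    by (rule inj_on_inverseI[of _ toggle]) (simp add: toggle2)
  moreover have "?X \<union> toggle ` ?X \<subseteq> Pow A"
    using a by (auto simp: toggle_def split: if_splits)
  ultimately have "card ?X + card ?X \<le> card (Pow A)"
    using assms by (metis (no_types, lifting) card_Un_disjoint card_image card_mono finite_Pow_iff finite_Un finite_subset)
  then show ?thesis using assms by (simp add: card_Pow)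
qed

lemma card_Un4_Bonferroni:
  assumes "finite P" "finite Q" "finite R" "finite S"
  shows "card P + card Q + card R + card S \<le> card (P \<union> Q \<union> R \<union> S)
    + card (P \<inter> Q) + card (P \<inter> R) + card (P \<inter> S) + card (Q \<inter> R) + card (Q \<inter> S) + card (R \<inter> S)"
proof -
  have "card P + card Q = card (P \<union> Q) + card (P \<inter> Q)"
    using assms by (intro card_Un_Int) auto
  moreover have "card (P \<union> Q) + card R = card (P \<union> Q \<union> R) + card ((P \<union> Q) \<inter> R)"
    using assms by (intro card_Un_Int) auto
  moreover have "card (P \<union> Q \<union> R) + card S = card (P \<union> Q \<union> R \<union> S) + card ((P \<union> Q \<union> R) \<inter> S)"
    using assms by (intro card_Un_Int) auto
  moreover have "card ((P \<union> Q) \<inter> R) \<le> card (P \<inter> R) + card (Q \<inter> R)"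
    using card_Un_le[of "P \<inter> R" "Q \<inter> R"] by (simp add: Int_Un_distrib2)
  moreover have "card ((P \<union> Q \<union> R) \<inter> S) \<le> card (P \<inter> S) + card (Q \<inter> S) + card (R \<inter> S)"
    using card_Un_le[of "P \<inter> S \<union> Q \<inter> S" "R \<inter> S"] card_Un_le[of "P \<inter> S" "Q \<inter> S"]
    by (simp add: Int_Un_distrib2)
  ultimately show ?thesis by linarith
qed

section \<open>Dense blocking sets\<close>

text \<open>
  Here \<open>V\<close> is the ambient space of the matroid and \<open>C\<close> is the complement of its ground set
  (so it contains \<open>0\<close>), with \<open>d = r(M) - t\<close>. The assumption \<open>hyperplane_case\<close> is the
  hypothesis for \<open>t - 1\<close>, again stated for complements.
\<close>

locale dense_blocking_set =
  fixes V C :: "(nat \<Rightarrow> bit) set" and d t :: nat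
  assumes V: "V2.subspace V" "finite V" "card V = 2 ^ (d + t)"
    and t: "t \<ge> 6"
    and C: "C \<subseteq> V" "0 \<in> C" "card C < 3 * 2 ^ d"
    and blocking: "\<And>T. V2.subspace T \<Longrightarrow> T \<subseteq> V \<Longrightarrow> card T = 2 ^ t \<Longrightarrow> T \<inter> C \<noteq> {0}"
    and no_subspace: "\<And>S. V2.subspace S \<Longrightarrow> S \<subseteq> C \<Longrightarrow> card S \<noteq> 2 ^ d"
    and hyperplane_case: "\<And>W A. V2.subspace W \<Longrightarrow> W \<subseteq> V \<Longrightarrow> 2 * card W = card V \<Longrightarrow>
        A \<subseteq> W \<Longrightarrow> 0 \<in> A \<Longrightarrow> card A < 3 * 2 ^ d \<Longrightarrow>
        (\<And>T. V2.subspace T \<Longrightarrow> T \<subseteq> W \<Longrightarrow> card T = 2 ^ (t - 1) \<Longrightarrow> T \<inter> A \<noteq> {0}) \<Longrightarrow>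
        \<exists>S. V2.subspace S \<and> S \<subseteq> A \<and> card S = 2 ^ d"
begin

section \<open>Hyperplanes, proper subspaces and projections\<close>

lemma finite_C: "finite C"
  using C V finite_subset by blast

lemma V_add: "x \<in> V \<Longrightarrow> y \<in> V \<Longrightarrow> x + y \<in> V"
  using V by (simp add: subspace_iff)

lemma two_pow_t: "2 * 2 ^ (t - 1) = (2::nat) ^ t"
  using t by (cases t) auto

text \<open>As \<open>C\<close> contains no subspace of size \<open>2 ^ d\<close>,
  \<open>hyperplane_case\<close> gives a \<open>T\<close> in \<open>H\<close> of size
  \<open>2 ^ (t - 1)\<close> that meets \<open>C\<close> only in \<open>0\<close>. Adjoining to
  \<open>T\<close> any point \<open>v + h\<close> outside \<open>H\<close> forces a point of
  \<open>C\<close> in the coset \<open>v + h + T\<close>. So the cosets of \<open>T\<close> through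
  the points \<open>c + v\<close>, with \<open>c\<close> in \<open>C - H\<close>, cover
  \<open>H\<close>.\<close>

lemma hyperplane_bound:
  assumes H: "V2.subspace H" "H \<subseteq> V" "2 * card H = card V"
  shows "2 ^ d \<le> card (C - H)"
proof -
  have H0: "0 \<in> H" and finH: "finite H"
    using H V finite_subset by (auto simp: subspace_iff)
  have "card (C \<inter> H) \<le> card C" using finite_C by (simp add: card_mono)
  then obtain T where T: "V2.subspace T" "T \<subseteq> H" "card T = 2 ^ (t - 1)" "T \<inter> (C \<inter> H) = {0}"
    using hyperplane_case[OF H, of "C \<inter> H"] no_subspace C H0 by fastforce
  have finT: "finite T" using T finH finite_subset by blast
  have TC: "T \<inter> C = {0}" using T by blast
  obtain v where v: "v \<in> V" "v \<notin> H"
  proof -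
    have "card V > 0" using V(3) by simp
    then have "card H \<noteq> card V" using H(3) by linarith
    then show thesis using that H(2) by (metis subsetI subset_antisym)
  qed
  have "H \<subseteq> (\<Union>c\<in>C - H. (+) (c + v) ` T)"
  proof
    fix h assume h: "h \<in> H"
    have vh: "v + h \<notin> H"
    proof
      assume "v + h \<in> H"
      then have "v + h + h \<in> H" using h H(1) V2.subspace_add by blast
      then show False using v by (simp only: vec_add_cancel)
    qed
    then have vhT: "v + h \<notin> T" using T by blast
    have "(T \<union> (+) (v + h) ` T) \<inter> C \<noteq> {0}"
    proof (rule blocking)
      show "V2.subspace (T \<union> (+) (v + h) ` T)"
        by (rule adjoin_subspace(1)[OF T(1) finT vhT])
      show "T \<union> (+) (v + h) ` T \<subseteq> V"
        using T(2) H(2) h v(1) V_add by (auto simp: subset_iff)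
      show "card (T \<union> (+) (v + h) ` T) = 2 ^ t"
        using adjoin_subspace(2)[OF T(1) finT vhT] T(3) two_pow_t by simp
    qed
    moreover have "0 \<in> T" using T by (simp add: subspace_iff)
    ultimately obtain s where s: "s \<in> T" "v + h + s \<in> C"
      using TC C(2) by blast
    have "v + h + s \<notin> H"
    proof
      assume "v + h + s \<in> H"
      then have "v + h + s + s \<in> H" using s T(2) H(1) V2.subspace_add by blast
      then show False using vh by (simp only: vec_add_cancel)
    qed
    moreover have "h = (v + h + s) + v + s"
    proof -
      have "(v + h + s) + v + s = h + (v + v) + (s + s)"
        by (simp only: add.assoc add.commute add.left_commute)
      then show ?thesis by (simp only: vec_self_add add_0_right)
    qed
    ultimately show "h \<in> (\<Union>c\<in>C - H. (+) (c + v) ` T)"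
      using s by blast
  qed
  then have "card H \<le> card (\<Union>c\<in>C - H. (+) (c + v) ` T)"
    using finT finite_C by (intro card_mono) auto
  also have "\<dots> \<le> (\<Sum>c\<in>C - H. card ((+) (c + v) ` T))"
    using finite_C by (intro card_UN_le) auto
  also have "\<dots> = card (C - H) * 2 ^ (t - 1)"
    using T(3) by (simp add: card_image)
  finally have "2 ^ (d + t) \<le> card (C - H) * (2 * 2 ^ (t - 1))"
    using H(3) V(3) by simp
  then show ?thesis
    unfolding two_pow_t power_add by simp
qed

text \<open>
  Average the bound on \<open>C - H\<close> over the hyperplanes \<open>H\<close> containing \<open>Z\<close>: they are the kernels
  of the sums of coordinates with respect to a basis of \<open>V\<close> that extends one of \<open>Z\<close>. Only
  \<open>2 / 2 ^ t \<le> 1 / 32\<close> is kept of the exact slope.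
\<close>

lemma subspace_bound:
  assumes Z: "V2.subspace Z" "Z \<subset> V"
  shows "32 * card (C \<inter> Z) < 32 * 2 ^ d + card Z"
proof -
  have finZ: "finite Z" using Z V finite_subset by blast
  obtain A where A: "A \<subseteq> Z" "V2.independent A" "Z \<subseteq> V2.span A" "card A = V2.dim Z"
    using V2.basis_exists by blast
  obtain B where B: "A \<subseteq> B" "B \<subseteq> V" "V2.independent B" "V \<subseteq> V2.span B"
    using V2.maximal_independent_subset_extend[of A V] A Z by blast
  have spanB: "V2.span B = V"
    using B V by (simp add: V2.span_minimal subset_antisym)
  have finB: "finite B" using B V finite_subset by blast
  define m where "m = card (B - A)"
  have dimV: "V2.dim V = card B"
    using B by (intro V2.dim_unique[of B]) auto
  have "card B = card A + m"
    using B(1) finB by (simp add: m_def card_Diff_subset card_mono finite_subset)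
  then have cardV: "card V = card Z * 2 ^ m"
    using card_subspace[OF V(1,2)] card_subspace[OF Z(1) finZ] A(4) dimV by (simp add: power_add)
  define g where "g I v = (\<Sum>b\<in>I. V2.representation B v b)" for I v
  have g_add: "g I (x + y) = g I x + g I y" if "x \<in> V" "y \<in> V" for I x y
    using that spanB by (simp only: g_def V2.representation_add[OF B(3)] sum.distrib)
  have lower: "2 ^ d \<le> card {v \<in> C. g I v = 1}" if I: "I \<subseteq> B - A" "I \<noteq> {}" for I
  proof -
    obtain b where b: "b \<in> I" using I by blast
    then have bB: "b \<in> B" using I by blast
    have "finite I" using I finB finite_subset by blast
    then have "g I b = 1"
      using b by (simp add: g_def V2.representation_basis[OF B(3) bB])
    then have "V2.subspace {v \<in> V. g I v = 0}" "2 * card {v \<in> V. g I v = 0} = card V"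
      using kernel_card[OF V(1,2), of "g I" b] g_add bB B(2) by auto
    then have "2 ^ d \<le> card (C - {v \<in> V. g I v = 0})"
      by (intro hyperplane_bound) auto
    also have "C - {v \<in> V. g I v = 0} = {v \<in> C. g I v = 1}"
      using C(1) by auto
    finally show ?thesis .
  qed
  \<comment> \<open>A point of \<open>Z\<close> has no coordinates outside \<open>A\<close>, so it
    lies in all these hyperplanes. Any other point is missed by at most half of \<open>2 ^ m\<close>
    of them, by \<open>card_odd_sums\<close>.\<close>
  have upper: "2 * card {I \<in> Pow (B - A) - {{}}. g I v = 1} \<le> (if v \<in> Z then 0 else 2 ^ m)"
    if v: "v \<in> C" for v
  proof (cases "v \<in> Z")
    case True
    have "V2.representation B v = V2.representation A v"
      using True A by (intro V2.representation_extend[OF B(3) _ B(1)]) blast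
    then have "V2.representation B v b = 0" if "b \<notin> A" for b
      using V2.representation_ne_zero[of A v b] that by metis
    then have "g I v = 0" if "I \<subseteq> B - A" for I
      unfolding g_def using that by (intro sum.neutral) blast
    then have "g I v \<noteq> 1" if "I \<in> Pow (B - A) - {{}}" for I
      using that by (metis DiffD1 PowD zero_neq_one)
    then have "{I \<in> Pow (B - A) - {{}}. g I v = 1} = {}" by blast
    then have "card {I \<in> Pow (B - A) - {{}}. g I v = 1} = 0" by (simp only: card.empty)
    then show ?thesis by (simp only: mult_0_right zero_le)
  next
    case False
    have "card {I \<in> Pow (B - A) - {{}}. g I v = 1} \<le> card {I \<in> Pow (B - A). g I v = 1}"
      using finB by (intro card_mono) auto
    then show ?thesis
      using False card_odd_sums[of "B - A" "V2.representation B v"] finB by (simp add: g_def m_def)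
  qed
  let ?P = "Pow (B - A) - {{}}"
  have finP: "finite ?P" using finB by simp
  have cardP: "card ?P = 2 ^ m - 1"
    using finB by (simp add: card_Pow m_def)
  have "2 * ((2 ^ m - 1) * 2 ^ d) \<le> 2 * (\<Sum>I\<in>?P. card {v \<in> C. g I v = 1})"
    using sum_mono[of ?P "\<lambda>_. 2 ^ d" "\<lambda>I. card {v \<in> C. g I v = 1}"] lower cardP by simp
  also have "\<dots> = 2 * (\<Sum>v\<in>C. card {I \<in> ?P. g I v = 1})"
    using sum.swap_restrict[OF finP finite_C, of "\<lambda>_ _. 1::nat" "\<lambda>I v. g I v = 1"] by simp
  also have "\<dots> \<le> (\<Sum>v\<in>C. if v \<in> Z then 0 else 2 ^ m)"
    unfolding sum_distrib_left by (intro sum_mono upper)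
  also have "\<dots> = card (C - Z) * 2 ^ m"
    using finite_C by (simp add: sum.If_cases Diff_eq Collect_neg_eq)
  finally have key: "2 * ((2 ^ m - 1) * 2 ^ d) \<le> card (C - Z) * 2 ^ m" .
  have "card (C \<inter> Z) + card (C - Z) = card C"
    using finite_C by (metis card_Int_Diff)
  then have split: "card (C - Z) < 3 * 2 ^ d - card (C \<inter> Z)"
    using C(3) by linarith
  \<comment> \<open>The reals are used because \<open>c - D\<close> may be negative. Since
    \<open>card Z * M = D * 2 ^ t\<close> and \<open>2 ^ t \<ge> 64\<close>, the bound
    \<open>(c - D) * M < 2 * D\<close> yields the slope \<open>1 / 32\<close>.\<close>
  define M :: real where "M = 2 ^ m"
  define D :: real where "D = 2 ^ d"
  define c where "c = real (card (C \<inter> Z))"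
  have M: "M > 0" and D: "D > 0" by (simp_all add: M_def D_def)
  have "real (2 * ((2 ^ m - 1) * 2 ^ d)) \<le> real (card (C - Z) * 2 ^ m)"
    using key of_nat_le_iff by blast
  then have "2 * ((M - 1) * D) \<le> real (card (C - Z)) * M"
    by (simp add: M_def D_def of_nat_diff)
  also have "\<dots> < (3 * D - c) * M"
  proof (rule mult_strict_right_mono[OF _ M])
    have "real (card (C - Z) + card (C \<inter> Z)) < real (3 * 2 ^ d)"
      using split unfolding of_nat_less_iff by linarith
    then show "real (card (C - Z)) < 3 * D - c"
      by (simp add: D_def c_def)
  qed
  finally have *: "(c - D) * M < 2 * D" by (simp add: algebra_simps)
  have z: "real (card Z) * M = D * 2 ^ t"
    using cardV V(3) unfolding M_def D_def by (metis of_nat_mult of_nat_numeral of_nat_power power_add)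
  have "(2::real) ^ 6 \<le> 2 ^ t" using t by (intro power_increasing) auto
  then have "32 * (2 * D) \<le> real (card Z) * M"
    unfolding z using D by simp
  then have "32 * (c - D) * M < real (card Z) * M" using * by linarith
  then have "32 * (c - D) < real (card Z)" using M by simp
  then have "real (32 * card (C \<inter> Z)) < real (32 * 2 ^ d + card Z)"
    by (simp add: c_def D_def)
  then show ?thesis by (simp only: of_nat_less_iff)
qed

text \<open>The quotient of \<open>V\<close> by \<open>x\<close> is modelled by a hyperplane
  \<open>W\<close> avoiding \<open>x\<close>, and the image of \<open>C\<close> by the set
  \<open>A\<close> of those \<open>w\<close> for which \<open>w\<close> or \<open>w + x\<close> lies
  in \<open>C\<close>. The subspace found inside \<open>A\<close> is then enlarged by
  \<open>x\<close>.\<close>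

lemma projection:
  assumes x: "x \<in> V" "x \<notin> C"
  obtains U where "V2.subspace U" "U \<subseteq> V" "card U = 2 * 2 ^ d" "x \<in> U"
    "\<And>v. v \<in> U \<Longrightarrow> v \<in> C \<or> v + x \<in> C"
proof -
  have x0: "x \<noteq> 0" using x C by blast
  obtain B where B: "{x} \<subseteq> B" "B \<subseteq> V" "V2.independent B" "V \<subseteq> V2.span B"
    using V2.maximal_independent_subset_extend[of "{x}" V] x x0 by (auto simp: V2.dependent_single)
  have spanB: "V2.span B = V"
    using B V by (simp add: V2.span_minimal subset_antisym)
  define W where "W = {v \<in> V. V2.representation B v x = 0}"
  have rep_x: "V2.representation B x x = 1"
    using B by (simp add: V2.representation_basis)
  have "V2.representation B (a + b) x = V2.representation B a x + V2.representation B b x"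
    if "a \<in> V" "b \<in> V" for a b
    using that spanB by (simp only: V2.representation_add[OF B(3)])
  note W = kernel_card[OF V(1,2), of "\<lambda>v. V2.representation B v x", OF this x(1) rep_x, folded W_def]
  have WV: "W \<subseteq> V" and xW: "x \<notin> W" using rep_x by (auto simp: W_def)
  have W0: "0 \<in> W" and W_add: "\<And>a b. a \<in> W \<Longrightarrow> b \<in> W \<Longrightarrow> a + b \<in> W"
    using W by (auto simp: subspace_iff)
  have finW: "finite W" using WV V finite_subset by blast
  have not_both: "w + x \<notin> W" if "w \<in> W" for w
  proof
    assume "w + x \<in> W"
    then have "w + x + w \<in> W" using that W_add by blast
    then show False using xW vec_add_cancel[of x w] by (simp only: add.commute)
  qed
  define A where "A = {w \<in> W. w \<in> C \<or> w + x \<in> C}"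
  have "\<exists>S. V2.subspace S \<and> S \<subseteq> A \<and> card S = 2 ^ d"
  proof (rule hyperplane_case[OF W(1) WV W(2)])
    show "A \<subseteq> W" "0 \<in> A" using W0 C by (auto simp: A_def)
    \<comment> \<open>Picks a point of \<open>C\<close> in the coset of \<open>w\<close>. Distinct
      points of \<open>W\<close> lie in distinct cosets of \<open>{0, x}\<close>, so
      \<open>A\<close> is no larger than \<open>C\<close>.\<close>
    define p where "p w = (if w \<in> C then w else w + x)" for w
    have "inj_on p A"
    proof (rule inj_onI)
      fix w w' assume "w \<in> A" "w' \<in> A" and eq: "p w = p w'"
      then have w: "w \<in> W" "w' \<in> W" by (auto simp: A_def)
      show "w = w'"
        using eq w not_both by (auto simp: p_def split: if_splits)
    qed
    moreover have "p ` A \<subseteq> C" by (auto simp: p_def A_def)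
    ultimately show "card A < 3 * 2 ^ d"
      using card_inj_on_le[OF _ _ finite_C] C(3) by (meson le_less_trans)
    fix T assume T: "V2.subspace T" "T \<subseteq> W" "card T = 2 ^ (t - 1)"
    have finT: "finite T" and xT: "x \<notin> T" using T finW xW finite_subset by blast+
    show "T \<inter> A \<noteq> {0}"
    proof
      \<comment> \<open>Such a \<open>T\<close> would lift to the subspace generated by
        \<open>T\<close> and \<open>x\<close>, which has size \<open>2 ^ t\<close> and misses
        \<open>C - {0}\<close>; the point \<open>x\<close> itself is no exception, as it is not in
        \<open>C\<close>.\<close>
      assume TA: "T \<inter> A = {0}"
      have "(T \<union> (+) x ` T) \<inter> C \<noteq> {0}"
      proof (rule blocking)
        show "V2.subspace (T \<union> (+) x ` T)" by (rule adjoin_subspace(1)[OF T(1) finT xT])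
        show "card (T \<union> (+) x ` T) = 2 ^ t"
          using adjoin_subspace(2)[OF T(1) finT xT] T(3) two_pow_t by simp
        show "T \<union> (+) x ` T \<subseteq> V" using T WV x V_add by auto
      qed
      moreover have "0 \<in> T" using T by (simp add: subspace_iff)
      ultimately obtain c where c: "c \<in> T \<union> (+) x ` T" "c \<in> C" "c \<noteq> 0"
        using C(2) by blast
      show False
      proof (cases "c \<in> T")
        case True
        then have "c \<in> T \<inter> A" using c T by (auto simp: A_def)
        then show False using TA c by blast
      next
        case False
        then obtain s where s: "s \<in> T" "c = x + s" using c by blast
        then have "s \<in> T \<inter> A" using c T by (auto simp: A_def add.commute)
        then have "s = 0" using TA by blast
        then show False using s c x by simp
      qed
    qed
  qed
  then obtain S where S: "V2.subspace S" "S \<subseteq> A" "card S = 2 ^ d" by blast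
  have SW: "S \<subseteq> W" using S by (auto simp: A_def)
  have finS: "finite S" and xS: "x \<notin> S" and S0: "0 \<in> S"
    using S SW finW xW finite_subset by (auto simp: subspace_iff)
  show thesis
  proof (rule that)
    show "V2.subspace (S \<union> (+) x ` S)" by (rule adjoin_subspace(1)[OF S(1) finS xS])
    show "card (S \<union> (+) x ` S) = 2 * 2 ^ d"
      using adjoin_subspace(2)[OF S(1) finS xS] S(3) by simp
    show "S \<union> (+) x ` S \<subseteq> V" using SW WV x V_add by auto
    show "x \<in> S \<union> (+) x ` S" using S0 by force
    fix v assume "v \<in> S \<union> (+) x ` S"
    then show "v \<in> C \<or> v + x \<in> C"
    proof
      assume "v \<in> (+) x ` S"
      then obtain s where s: "s \<in> S" "v = x + s" by blast
      then have "v + x = s" using vec_add_cancel[of s x] by (simp only: add.commute)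
      moreover have "s \<in> C \<or> s + x \<in> C" using s S by (auto simp: A_def)
      ultimately show ?thesis using s by (auto simp: add.commute)
    qed (use S in \<open>auto simp: A_def\<close>)
  qed
qed

section \<open>Intersections of subspaces at least half filled by \<open>C\<close>\<close>

definition half_dense :: "(nat \<Rightarrow> bit) set \<Rightarrow> bool" where
  "half_dense U \<longleftrightarrow> V2.subspace U \<and> U \<subseteq> V \<and> card U = 2 * 2 ^ d \<and> 2 ^ d \<le> card (C \<inter> U)"

lemma card_V_ge: "64 * 2 ^ d \<le> card V"
proof -
  have "(2::nat) ^ 6 \<le> 2 ^ t" using t by (intro power_increasing) auto
  then show ?thesis by (simp add: V power_add)
qed

text \<open>Replaces properness by a size condition. The constant \<open>16\<close> is the first
  crude estimate for the sum of two half-dense subspaces in \<open>half_dense_inter\<close>.\<close>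

lemma small_subspace_bound:
  assumes "V2.subspace Z" "Z \<subseteq> V" "card Z \<le> 16 * 2 ^ d"
  shows "32 * card (C \<inter> Z) < 32 * 2 ^ d + card Z"
proof (rule subspace_bound[OF assms(1)])
  have "card Z < 64 * 2 ^ d" using assms(3) zero_less_power[of "2::nat" d] by linarith
  then have "card Z \<noteq> card V" using card_V_ge by linarith
  then show "Z \<subset> V" using assms(2) by blast
qed

text \<open>Inclusion-exclusion inside the sum \<open>?P\<close> gives
  \<open>2 * D \<le> card (C \<inter> ?P) + card (C \<inter> ?I)\<close>, and
  \<open>small_subspace_bound\<close> is applied to \<open>?P\<close> twice. The crude estimate
  \<open>card ?P \<le> 16 * D\<close> leaves more than \<open>D / 2\<close> points of
  \<open>C\<close> in \<open>?I\<close>, which forces \<open>card ?I = D\<close>. Then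
  \<open>card ?P \<le> 4 * D\<close>, and the second application leaves more than
  \<open>7 * D / 8\<close>.\<close>

lemma half_dense_inter:
  assumes U: "half_dense U" and U': "half_dense U'" and "U \<noteq> U'"
    and near: "2 ^ d < 8 * card (C \<inter> (U \<inter> U'))"
  shows "card (U \<inter> U') = 2 ^ d" "7 * 2 ^ d < 8 * card (C \<inter> (U \<inter> U'))"
proof -
  define D :: nat where "D = 2 ^ d"
  let ?I = "U \<inter> U'" and ?P = "{x + y |x y. x \<in> U \<and> y \<in> U'}"
  have sub: "V2.subspace U" "V2.subspace U'" and UV: "U \<subseteq> V" "U' \<subseteq> V"
    and cards: "card U = 2 * D" "card U' = 2 * D" "D \<le> card (C \<inter> U)" "D \<le> card (C \<inter> U')"
    using U U' by (auto simp: half_dense_def D_def)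
  have fin: "finite U" "finite U'" using UV V finite_subset by auto
  have I: "V2.subspace ?I" using sub by (rule V2.subspace_inter)
  define e where "e = V2.dim ?I"
  have cI: "card ?I = 2 ^ e" using card_subspace[OF I] fin by (simp add: e_def)
  have "?I \<subset> U"
  proof -
    have "?I \<noteq> U"
    proof
      assume "?I = U"
      then have "U \<subseteq> U'" by blast
      then have "U = U'" using card_subset_eq[OF fin(2)] cards by simp
      then show False using \<open>U \<noteq> U'\<close> by simp
    qed
    then show ?thesis by blast
  qed
  then have ID: "card ?I \<le> D"
    using card_psubset_subspace[OF I sub(1) fin(1)] cards by simp
  have cI_le: "card (C \<inter> ?I) \<le> card ?I"
    using fin by (intro card_mono) auto
  have P: "V2.subspace ?P" "?P \<subseteq> V"
    using sub UV V_add by (auto intro: V2.subspace_sums)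
  then have finP: "finite ?P" using V finite_subset by blast
  have PI: "card ?P * card ?I \<le> 2 * D * (2 * D)"
    using card_sums_Int[OF sub(1) fin(1) sub(2) fin(2)] cards by simp
  have "U \<union> U' \<subseteq> ?P"
  proof -
    have "x = x + 0" "x = 0 + x" for x :: "nat \<Rightarrow> bit" by simp_all
    then show ?thesis using sub V2.subspace_0 by blast
  qed
  then have "card ((C \<inter> U) \<union> (C \<inter> U')) \<le> card (C \<inter> ?P)"
    using finP by (intro card_mono) auto
  moreover have "card (C \<inter> U) + card (C \<inter> U') = card ((C \<inter> U) \<union> (C \<inter> U')) + card ((C \<inter> U) \<inter> (C \<inter> U'))"
    using fin by (intro card_Un_Int) auto
  moreover have "(C \<inter> U) \<inter> (C \<inter> U') = C \<inter> ?I" by blast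
  ultimately have sum: "2 * D \<le> card (C \<inter> ?P) + card (C \<inter> ?I)"
    using cards by simp
  have D0: "D > 0" by (simp add: D_def)
  \<comment> \<open>Since \<open>card ?I\<close> is a power of two, exceeding \<open>D / 8\<close>
    means being at least \<open>D / 4\<close>.\<close>
  have "(2::nat) ^ d < 2 ^ (e + 3)"
    using near cI_le cI by (simp add: power_add)
  then have "d \<le> e + 2" by (simp only: power_strict_increasing_iff[of "2::nat"])
  then have "D \<le> 2 ^ (e + 2)" unfolding D_def by (intro power_increasing) auto
  then have D4: "D \<le> 4 * card ?I" by (simp add: cI power_add)
  have "card ?P * D \<le> card ?P * (4 * card ?I)" using D4 by (rule mult_le_mono2)
  then have "card ?P * D \<le> 16 * D * D" using PI by linarith
  then have P16: "card ?P \<le> 16 * D" using D0 by simp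
  then have "32 * card (C \<inter> ?P) < 32 * D + card ?P"
    using small_subspace_bound[OF P] by (simp add: D_def)
  then have "D < 2 * card (C \<inter> ?I)" using sum P16 by linarith
  then have "(2::nat) ^ d < 2 ^ (e + 1)" using cI_le cI by (simp add: D_def)
  then have "d \<le> e" by (simp only: power_strict_increasing_iff[of "2::nat"])
  then have "D \<le> card ?I" unfolding D_def cI by (intro power_increasing) auto
  then have ID: "card ?I = D" using ID by simp
  then show "card ?I = 2 ^ d" by (simp add: D_def)
  have "card ?P \<le> 4 * D" using PI D0 by (simp add: ID)
  moreover have "32 * card (C \<inter> ?P) < 32 * D + card ?P"
    using small_subspace_bound[OF P] P16 by (simp add: D_def)
  ultimately have "7 * D < 8 * card (C \<inter> ?I)" using sum by linarith
  then show "7 * 2 ^ d < 8 * card (C \<inter> ?I)" by (simp add: D_def)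
qed

text \<open>Two different intersections would share at most \<open>D / 2\<close> points, so together
  they would hold more than \<open>7 * D / 4 - D / 2 = 5 * D / 4\<close> points of \<open>C\<close>,
  while \<open>U\<close> holds fewer than \<open>17 * D / 16\<close>.\<close>

lemma half_dense_inter_unique:
  assumes U: "half_dense U" and U': "half_dense U'" "U \<noteq> U'" "2 ^ d < 8 * card (C \<inter> (U \<inter> U'))"
    and U'': "half_dense U''" "U \<noteq> U''" "2 ^ d < 8 * card (C \<inter> (U \<inter> U''))"
  shows "U \<inter> U' = U \<inter> U''"
proof (rule ccontr)
  define D :: nat where "D = 2 ^ d"
  let ?I = "U \<inter> U'" and ?J = "U \<inter> U''"
  assume neq: "?I \<noteq> ?J"
  have I: "card ?I = D" "7 * D < 8 * card (C \<inter> ?I)"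
    using half_dense_inter[OF U U'] by (auto simp: D_def)
  have J: "card ?J = D" "7 * D < 8 * card (C \<inter> ?J)"
    using half_dense_inter[OF U U''] by (auto simp: D_def)
  have sub: "V2.subspace U" "V2.subspace U'" "V2.subspace U''" and UV: "U \<subseteq> V" and cU: "card U = 2 * D"
    using U U' U'' by (auto simp: half_dense_def D_def)
  have fin: "finite U" using UV V finite_subset by auto
  have "?I \<inter> ?J \<subset> ?I"
  proof -
    have "\<not> ?I \<subseteq> ?J"
      using card_subset_eq[of ?J ?I] fin I(1) J(1) neq by auto
    then show ?thesis by blast
  qed
  then have small: "2 * card (?I \<inter> ?J) \<le> D"
    using card_psubset_subspace[of "?I \<inter> ?J" ?I] sub fin I(1) by (simp add: V2.subspace_inter)
  have "card (C \<inter> ?I) + card (C \<inter> ?J) = card ((C \<inter> ?I) \<union> (C \<inter> ?J)) + card ((C \<inter> ?I) \<inter> (C \<inter> ?J))"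
    using fin by (intro card_Un_Int) auto
  moreover have "card ((C \<inter> ?I) \<union> (C \<inter> ?J)) \<le> card (C \<inter> U)"
    using fin by (intro card_mono) auto
  moreover have "card ((C \<inter> ?I) \<inter> (C \<inter> ?J)) \<le> card (?I \<inter> ?J)"
    using fin by (intro card_mono) auto
  moreover have "32 * card (C \<inter> U) < 32 * D + 2 * D"
    using small_subspace_bound[OF sub(1) UV] cU by (simp add: D_def)
  ultimately show False using I(2) J(2) small by linarith
qed

text \<open>The unordered pairs state the six bounds symmetrically, so a caller need not match the
  order within a pair.\<close>

lemma half_dense_card_far:
  assumes "half_dense P" "half_dense Q" "half_dense R" "half_dense S"
    and "\<And>X Y. {X, Y} \<in> {{P, Q}, {P, R}, {P, S}, {Q, R}, {Q, S}, {R, S}} \<Longrightarrow>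
      8 * card (C \<inter> (X \<inter> Y)) \<le> 2 ^ d"
  shows False
proof -
  have eq: "(C \<inter> X) \<inter> (C \<inter> Y) = C \<inter> (X \<inter> Y)" for X Y by blast
  have fin: "finite (C \<inter> X)" for X using finite_C by simp
  have "card ((C \<inter> P) \<union> (C \<inter> Q) \<union> (C \<inter> R) \<union> (C \<inter> S)) \<le> card C"
    using finite_C by (intro card_mono) auto
  moreover have "2 ^ d \<le> card (C \<inter> P)" "2 ^ d \<le> card (C \<inter> Q)" "2 ^ d \<le> card (C \<inter> R)" "2 ^ d \<le> card (C \<inter> S)"
    using assms by (auto simp: half_dense_def)
  moreover have "8 * card (C \<inter> (P \<inter> Q)) \<le> 2 ^ d" "8 * card (C \<inter> (P \<inter> R)) \<le> 2 ^ d"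
    "8 * card (C \<inter> (P \<inter> S)) \<le> 2 ^ d" "8 * card (C \<inter> (Q \<inter> R)) \<le> 2 ^ d"
    "8 * card (C \<inter> (Q \<inter> S)) \<le> 2 ^ d" "8 * card (C \<inter> (R \<inter> S)) \<le> 2 ^ d"
    using assms(5) by simp_all
  moreover note card_Un4_Bonferroni[OF fin fin fin fin, of P Q R S, unfolded eq]
  ultimately show False
    using C(3) by linarith
qed

theorem inconsistent: False
proof -
  define D :: nat where "D = 2 ^ d"
  have "\<forall>x\<in>V - C. \<exists>U. V2.subspace U \<and> U \<subseteq> V \<and> card U = 2 * 2 ^ d \<and> x \<in> U \<and>
      (\<forall>v\<in>U. v \<in> C \<or> v + x \<in> C)"
    using projection by (metis DiffD1 DiffD2)
  then obtain U where U: "\<And>x. x \<in> V - C \<Longrightarrow> V2.subspace (U x) \<and> U x \<subseteq> V \<and> card (U x) = 2 * 2 ^ d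
      \<and> x \<in> U x \<and> (\<forall>v\<in>U x. v \<in> C \<or> v + x \<in> C)"
    by metis
  have finV: "finite V" by (rule V(2))
  \<comment> \<open>\<open>U x\<close> is covered by \<open>C \<inter> U x\<close> and its translate
    by \<open>x\<close>, so at least half of it lies in \<open>C\<close>.\<close>
  have hd: "half_dense (U x)" if x: "x \<in> V - C" for x
  proof -
    have fin: "finite (U x)" using U[OF x] finV finite_subset by blast
    have "U x \<subseteq> (C \<inter> U x) \<union> (\<lambda>v. v + x) ` (C \<inter> U x)"
    proof
      fix v assume v: "v \<in> U x"
      have "v + x \<in> U x" using v U[OF x] V2.subspace_add by blast
      moreover have "v = (v + x) + x" by (simp only: vec_add_cancel)
      ultimately show "v \<in> (C \<inter> U x) \<union> (\<lambda>v. v + x) ` (C \<inter> U x)"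
        using v U[OF x] by blast
    qed
    then have "card (U x) \<le> card ((C \<inter> U x) \<union> (\<lambda>v. v + x) ` (C \<inter> U x))"
      using fin by (intro card_mono) auto
    also have "\<dots> \<le> card (C \<inter> U x) + card (C \<inter> U x)"
      using card_Un_le card_image_le[of "C \<inter> U x" "\<lambda>v. v + x"] fin
      by (meson add_left_mono finite_Int le_trans)
    finally show ?thesis using U[OF x] by (simp add: half_dense_def)
  qed
  define N where "N y = {x \<in> V - C. 2 ^ d < 8 * card (C \<inter> (U y \<inter> U x))}" for y
  have N: "card (N y) < 5 * D" if y: "y \<in> V - C" for y
  proof -
    have fin: "finite (U y)" using U[OF y] finV finite_subset by blast
    obtain k where k: "N y - U y \<subseteq> (\<lambda>c. c + k) ` C"
    proof (cases "N y - U y = {}")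
      case True
      then show thesis using that by blast
    next
      case False
      then obtain z where z: "z \<in> N y" "z \<notin> U y" by blast
      let ?K = "U y \<inter> U z"
      \<comment> \<open>As \<open>x\<close> lies in \<open>U x\<close> but not in
        \<open>U y\<close>, these subspaces differ and \<open>half_dense_inter_unique\<close>
        applies.\<close>
      have K: "U y \<inter> U x = ?K" if "x \<in> N y" "x \<notin> U y" for x
        using that z U[of x] U[of z] hd y
        by (intro half_dense_inter_unique) (auto simp: N_def)
      have "card ?K = 2 ^ d"
        using z U[of z] hd y by (intro half_dense_inter) (auto simp: N_def)
      moreover have "V2.subspace ?K"
        using z y U by (auto simp: N_def intro: V2.subspace_inter)
      \<comment> \<open>\<open>?K\<close> has the size forbidden for subspaces of \<open>C\<close>.
        As \<open>k\<close> lies in every such \<open>U x\<close> but not in \<open>C\<close>, the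
        coset condition puts \<open>k + x\<close> in \<open>C\<close>.\<close>
      ultimately obtain k where k: "k \<in> ?K" "k \<notin> C"
        using no_subspace by blast
      have "x \<in> (\<lambda>c. c + k) ` C" if x: "x \<in> N y - U y" for x
      proof -
        have "k \<in> U x" using K[of x] x k by blast
        moreover have "x \<in> V - C" using x by (simp add: N_def)
        ultimately have "k + x \<in> C" using U[of x] k by blast
        moreover have "x = (k + x) + k"
          using vec_add_cancel[of x k] by (simp only: add.commute)
        ultimately show ?thesis by blast
      qed
      then show thesis using that by blast
    qed
    have "N y \<subseteq> U y \<union> (\<lambda>c. c + k) ` C" using k by blast
    then have "card (N y) \<le> card (U y \<union> (\<lambda>c. c + k) ` C)"
      using fin finite_C by (intro card_mono) auto
    also have "\<dots> \<le> card (U y) + card C"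
      using card_Un_le card_image_le[OF finite_C] by (meson add_left_mono le_trans)
    also have "\<dots> < 5 * D" using U[OF y] C(3) by (simp add: D_def)
    finally show ?thesis .
  qed
  \<comment> \<open>Three sets \<open>N y\<close> cover at most \<open>15 * D\<close> points, but
    \<open>V - C\<close> has more than \<open>61 * D\<close>. The four points below are chosen
    greedily; \<open>card_length\<close> bounds the sizes of the sets of earlier choices without
    proving these distinct.\<close>
  have escape: "\<exists>x\<in>V - C. \<forall>y\<in>Y. 8 * card (C \<inter> (U y \<inter> U x)) \<le> 2 ^ d"
    if Y: "Y \<subseteq> V - C" "finite Y" "card Y \<le> 3" for Y
  proof (rule ccontr)
    assume "\<not> ?thesis"
    then have "V - C \<subseteq> (\<Union>y\<in>Y. N y)"
      by (auto simp: N_def not_le)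
    moreover have "finite (\<Union>y\<in>Y. N y)" using Y finV by (auto simp: N_def)
    ultimately have "card (V - C) \<le> card (\<Union>y\<in>Y. N y)" by (rule card_mono[rotated])
    also have "\<dots> \<le> (\<Sum>y\<in>Y. card (N y))" using Y by (intro card_UN_le) auto
    also have "\<dots> \<le> (\<Sum>y\<in>Y. 5 * D)"
      using N Y by (intro sum_mono) (auto intro: less_imp_le)
    also have "\<dots> \<le> 15 * D" using Y by simp
    finally have "card (V - C) \<le> 15 * D" .
    moreover have "card (V - C) = card V - card C"
      using finite_C C by (simp add: card_Diff_subset)
    ultimately show False using card_V_ge C(3) by (simp add: D_def)
  qed
  obtain p where p: "p \<in> V - C" using escape[of "{}"] by auto
  obtain q where q: "q \<in> V - C" "8 * card (C \<inter> (U p \<inter> U q)) \<le> 2 ^ d"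
    using escape[of "{p}"] p by auto
  obtain r where r: "r \<in> V - C" "\<forall>y\<in>{p, q}. 8 * card (C \<inter> (U y \<inter> U r)) \<le> 2 ^ d"
    using escape[of "{p, q}"] p q card_length[of "[p, q]"] by auto
  obtain s where s: "s \<in> V - C" "\<forall>y\<in>{p, q, r}. 8 * card (C \<inter> (U y \<inter> U s)) \<le> 2 ^ d"
    using escape[of "{p, q, r}"] p q r card_length[of "[p, q, r]"] by auto
  show False
    by (rule half_dense_card_far[of "U p" "U q" "U r" "U s"])
      (use p q r s hd in \<open>auto simp: doubleton_eq_iff Int_commute\<close>)
qed

end

section \<open>Critical numbers and projective geometries\<close>

lemma additive_zero:
  fixes f :: "(nat \<Rightarrow> bit) \<Rightarrow> (nat \<Rightarrow> bit)"
  assumes "f (0 + 0) = f 0 + f 0"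
  shows "f 0 = 0"
  using assms by (simp only: vec_self_add)

text \<open>The zero subspace is a candidate of codimension \<open>rk M\<close>, so the minimum is
  attained.\<close>

lemma critical_number_witness:
  assumes "simple_binary_matroid M"
  obtains W where "V2.subspace W" "W \<subseteq> F2 (rk M)" "V2.dim W + critical_number M = rk M"
    "W \<inter> elts M = {}"
proof -
  let ?P = "\<lambda>k. \<exists>W. V2.subspace W \<and> W \<subseteq> F2 (rk M) \<and> V2.dim W + k = rk M \<and> W \<inter> elts M = {}"
  have "{0} \<subseteq> F2 (rk M)" using subspace_F2 V2.subspace_0 by blast
  moreover have "V2.dim {0} = 0"
    using dim_eq_iff_card[of "{0}" 0] V2.subspace_single_0 by simp
  moreover have "{0} \<inter> elts M = {}"
    using assms by (auto simp: simple_binary_matroid_def)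
  ultimately have "?P (rk M)"
    using V2.subspace_single_0 by (intro exI[of _ "{0}"]) simp
  then have "?P (critical_number M)"
    unfolding critical_number_def by (rule LeastI)
  then show thesis using that by blast
qed

lemma critical_number_le:
  assumes "V2.subspace W" "W \<subseteq> F2 (rk M)" "V2.dim W + k = rk M" "W \<inter> elts M = {}"
  shows "critical_number M \<le> k"
  unfolding critical_number_def using assms by (intro Least_le) blast

lemma contains_proj_geomI:
  assumes T: "V2.subspace T" "T \<subseteq> F2 (rk M)" "card T = 2 ^ s" "T - {0} \<subseteq> elts M"
  shows "contains M (proj_geom s)"
proof -
  have finT: "finite T" using T(2) finite_F2 finite_subset by blast
  then have "V2.dim T = s" using dim_eq_iff_card[OF T(1)] T(3) by blast
  then obtain f :: "(nat \<Rightarrow> bit) \<Rightarrow> (nat \<Rightarrow> bit)" where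
    f: "\<And>x y. f (x + y) = f x + f y" "inj_on f (F2 s)" "f ` F2 s = T"
    using subspace_parametrization[OF T(1) finT] by blast
  have f0: "f 0 = 0" using f(1) by (rule additive_zero)
  have "f (scale2 c x) = scale2 c (f x)" for c x
    by (cases "c = 0") (simp_all add: f0)
  then have "linear_F2 s (rk M) f"
    unfolding linear_F2_def using f T(2) by blast
  moreover have "f v \<in> elts M" if v: "v \<in> F2 s - {0}" for v
  proof -
    have "0 \<in> F2 s" using subspace_F2 V2.subspace_0 by blast
    then have "f v \<noteq> f 0" using v f(2) by (metis DiffD1 DiffD2 inj_onD singletonI)
    then show ?thesis using v f(3) f0 T(4) by auto
  qed
  ultimately show ?thesis
    using f(2) by (auto simp: contains_def proj_geom_def)
qed

lemma contains_proj_geomE: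
  assumes "contains M (proj_geom s)"
  obtains T where "V2.subspace T" "T \<subseteq> F2 (rk M)" "card T = 2 ^ s" "T - {0} \<subseteq> elts M"
proof -
  obtain g where g: "linear_F2 s (rk M) g" "inj_on g (F2 s)" "g ` (F2 s - {0}) \<subseteq> elts M"
    using assms by (auto simp: contains_def proj_geom_def)
  have add: "g (x + y) = g x + g y" if "x \<in> F2 s" "y \<in> F2 s" for x y
    using g(1) that by (auto simp: linear_F2_def)
  have "0 \<in> F2 s" using subspace_F2 V2.subspace_0 by blast
  then have "g 0 = 0" using add by (intro additive_zero) blast
  show thesis
  proof
    show "V2.subspace (g ` F2 s)" using add subspace_F2 by (rule additive_image_subspace)
    show "g ` F2 s \<subseteq> F2 (rk M)" using g(1) by (simp add: linear_F2_def)
    show "card (g ` F2 s) = 2 ^ s" using g(2) by (simp add: card_image)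
    show "g ` F2 s - {0} \<subseteq> elts M" using g(3) \<open>g 0 = 0\<close> by auto
  qed
qed

text \<open>Coordinates on \<open>W\<close> turn the complement of \<open>A\<close> into the ground
  set of a matroid of rank \<open>d + t\<close>. A bound \<open>t\<close> on its critical number
  means that \<open>A\<close> contains a subspace of dimension \<open>d\<close>. The
  \<open>t\<close> here is one less than that of the final theorem.\<close>

lemma critical_number_bound_transfer:
  assumes t: "t \<ge> 3"
    and hyp: "\<And>M. simple_binary_matroid M \<Longrightarrow> free_of (proj_geom t) M \<Longrightarrow>
           real (card (elts M)) > (1 - 3 / 2 ^ t) * 2 ^ rk M \<Longrightarrow> critical_number M \<le> t"
    and W: "V2.subspace W" "finite W" "card W = 2 ^ (d + t)"
    and A: "A \<subseteq> W" "0 \<in> A" "card A < 3 * 2 ^ d"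
    and blocking: "\<And>T. V2.subspace T \<Longrightarrow> T \<subseteq> W \<Longrightarrow> card T = 2 ^ t \<Longrightarrow> T \<inter> A \<noteq> {0}"
  obtains S where "V2.subspace S" "S \<subseteq> A" "card S = 2 ^ d"
proof -
  define m where "m = d + t"
  have "V2.dim W = m" using dim_eq_iff_card[OF W(1,2)] W(3) by (simp add: m_def)
  then obtain f :: "(nat \<Rightarrow> bit) \<Rightarrow> (nat \<Rightarrow> bit)" where
    f: "\<And>x y. f (x + y) = f x + f y" "inj_on f (F2 m)" "f ` F2 m = W"
    using subspace_parametrization[OF W(1,2)] by blast
  have f0: "f 0 = 0" using f(1) by (rule additive_zero)
  define E where "E = {v \<in> F2 m. f v \<notin> A}"
  have E: "E \<subseteq> F2 m - {0}" using A(2) f0 by (auto simp: E_def)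
  have finE: "finite E" using finite_F2[of m] by (simp add: E_def)
  have "f ` E = W - A" using f(3) by (auto simp: E_def)
  then have "card E = card (W - A)"
    using inj_on_subset[OF f(2), of E] E by (metis Diff_subset card_image subset_trans)
  then have cE: "card E + card A = 2 ^ m"
    using A(1) W(2,3) card_mono[OF W(2) A(1)]
    by (simp add: card_Diff_subset finite_subset m_def)
  define M where "M = \<lparr>rk = m, elts = E\<rparr>"
  have M: "simple_binary_matroid M"
  proof -
    have span: "V2.subspace (V2.span E)" "V2.span E \<subseteq> F2 m"
      using E subspace_F2 by (auto intro: V2.subspace_span V2.span_minimal[THEN subsetD])
    have finS: "finite (V2.span E)" using span finite_F2 finite_subset by blast
    have "card E \<le> card (V2.span E)"
      using finS V2.span_superset by (rule card_mono)
    \<comment> \<open>\<open>E\<close> contains more than \<open>5 / 8\<close> of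
      \<open>F2 m\<close>, whereas a proper subspace has at most half of the points; hence
      \<open>E\<close> spans.\<close>
    moreover have "8 * 2 ^ d \<le> (2::nat) ^ m"
    proof -
      have "(2::nat) ^ 3 \<le> 2 ^ t" using t by (intro power_increasing) auto
      then show ?thesis by (simp add: m_def power_add)
    qed
    ultimately have "\<not> 2 * card (V2.span E) \<le> card (F2 m)"
      using A(3) cE card_F2[of m] by linarith
    then have "V2.span E = F2 m"
      using card_psubset_subspace[OF span(1) subspace_F2 finite_F2] span(2) by blast
    then show ?thesis using E by (simp add: simple_binary_matroid_def M_def)
  qed
  have "critical_number M \<le> t"
  proof (rule hyp[OF M])
    show "free_of (proj_geom t) M"
    proof
      assume "contains M (proj_geom t)"
      then obtain T where T: "V2.subspace T" "T \<subseteq> F2 m" "card T = 2 ^ t" "T - {0} \<subseteq> E"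
        by (rule contains_proj_geomE) (simp add: M_def)
      have "V2.subspace (f ` T)" using f(1) T(1) by (rule additive_image_subspace)
      moreover have "f ` T \<subseteq> W" using T(2) f(3) by blast
      moreover have "card (f ` T) = 2 ^ t"
        using inj_on_subset[OF f(2) T(2)] T(3) by (simp add: card_image)
      moreover have "f ` T \<inter> A = {0}"
      proof -
        have "0 \<in> f ` T" using T(1) V2.subspace_0 f0 by (metis imageI)
        moreover have "f v = 0" if "v \<in> T" "f v \<in> A" for v
          using that T(4) f0 by (auto simp: E_def)
        ultimately show ?thesis using A(2) by blast
      qed
      ultimately show False using blocking by blast
    qed
    have "(1 - 3 / 2 ^ t) * 2 ^ m = 2 ^ m - 3 * (2::real) ^ d"
      by (simp add: m_def power_add field_simps)
    also have "\<dots> < 2 ^ m - real (card A)"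
    proof -
      have "real (card A) < real (3 * 2 ^ d)" using A(3) by (simp only: of_nat_less_iff)
      then show ?thesis by simp
    qed
    also have "\<dots> = real (card E)"
    proof -
      have "real (card E + card A) = 2 ^ m" by (simp add: cE)
      then show ?thesis by simp
    qed
    finally show "(1 - 3 / 2 ^ t) * 2 ^ rk M < real (card (elts M))"
      by (simp add: M_def)
  qed
  moreover obtain W' where W': "V2.subspace W'" "W' \<subseteq> F2 m" "V2.dim W' + critical_number M = m"
    "W' \<inter> E = {}"
    using critical_number_witness[OF M] by (auto simp: M_def)
  \<comment> \<open>\<open>W'\<close> may be too large, so a subspace of dimension exactly
    \<open>d\<close> is cut out of it. Missing \<open>E\<close>, it is mapped by \<open>f\<close>
    into \<open>A\<close>.\<close>
  ultimately have "d \<le> V2.dim W'" by (simp add: m_def)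
  moreover have "finite W'" using W'(2) finite_F2 finite_subset by blast
  ultimately obtain S where S: "V2.subspace S" "S \<subseteq> W'" "card S = 2 ^ d"
    using subspace_of_card[OF W'(1) _ card_subspace[OF W'(1)]] by blast
  show thesis
  proof
    show "V2.subspace (f ` S)" using f(1) S(1) by (rule additive_image_subspace)
    show "card (f ` S) = 2 ^ d"
      using inj_on_subset[OF f(2), of S] S W'(2) by (simp add: card_image)
    show "f ` S \<subseteq> A" using S(2) W'(2,4) by (auto simp: E_def)
  qed
qed

text \<open>A counterexample makes the complement of its ground set a
  \<open>dense_blocking_set\<close>, and that locale is contradictory.\<close>

theorem theorem2p10:
  fixes t :: nat
  assumes "t \<ge> 6"
    and "\<And>M'. simple_binary_matroid M' \<Longrightarrow> free_of (proj_geom (t - 1)) M' \<Longrightarrow>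
           real (card (elts M')) > (1 - 3 / 2 ^ (t - 1)) * 2 ^ rk M' \<Longrightarrow>
           critical_number M' \<in> {t - 2, t - 1}"
  shows "\<not> (\<exists>M. simple_binary_matroid M \<and> free_of (proj_geom t) M \<and>
           real (card (elts M)) > (1 - 3 / 2 ^ t) * 2 ^ rk M \<and>
           critical_number M > t)"
proof
  assume "\<exists>M. simple_binary_matroid M \<and> free_of (proj_geom t) M \<and>
    real (card (elts M)) > (1 - 3 / 2 ^ t) * 2 ^ rk M \<and> critical_number M > t"
  then obtain M where M: "simple_binary_matroid M" "free_of (proj_geom t) M"
    "real (card (elts M)) > (1 - 3 / 2 ^ t) * 2 ^ rk M" "critical_number M > t" by blast
  let ?V = "F2 (rk M)" and ?C = "F2 (rk M) - elts M"
  have E: "elts M \<subseteq> ?V - {0}" using M(1) by (simp add: simple_binary_matroid_def)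
  define d where "d = rk M - t"
  \<comment> \<open>The subtraction in \<open>d\<close> is not truncated: the critical number
    exceeds \<open>t\<close> and is at most the rank.\<close>
  have n: "rk M = d + t"
    using critical_number_witness[OF M(1)] M(4) by (metis d_def le_add2 le_add_diff_inverse2 less_imp_le order.trans)
  interpret dense_blocking_set ?V ?C d t
  proof
    show "V2.subspace ?V" by (rule subspace_F2)
    show "finite ?V" "card ?V = 2 ^ (d + t)" by (simp_all add: n)
    show "t \<ge> 6" by (rule assms(1))
    show "?C \<subseteq> ?V" by blast
    show "0 \<in> ?C" using E subspace_F2 V2.subspace_0 by blast
    show "card ?C < 3 * 2 ^ d"
    proof -
      have EV: "elts M \<subseteq> ?V" using E by blast
      then have "finite (elts M)" using finite_F2 finite_subset by blast
      then have "card ?C + card (elts M) = 2 ^ (d + t)"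
        using EV n card_mono[of ?V "elts M"] by (simp add: card_Diff_subset)
      then have "real (card ?C) + real (card (elts M)) = 2 ^ (d + t)"
        by (metis of_nat_add of_nat_numeral of_nat_power)
      moreover have "(1 - 3 / 2 ^ t) * 2 ^ rk M = 2 ^ (d + t) - 3 * (2::real) ^ d"
        by (simp add: n power_add field_simps)
      ultimately have "real (card ?C) < 3 * 2 ^ d" using M(3) by linarith
      also have "\<dots> = real (3 * 2 ^ d)" by simp
      finally show ?thesis by (simp only: of_nat_less_iff)
    qed
    show "T \<inter> ?C \<noteq> {0}" if "V2.subspace T" "T \<subseteq> ?V" "card T = 2 ^ t" for T
      using that contains_proj_geomI[of T M t] M(2) by blast
    \<comment> \<open>A subspace of that size would miss the ground set and have codimension
      \<open>t\<close>.\<close>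
    show "card S \<noteq> 2 ^ d" if S: "V2.subspace S" "S \<subseteq> ?C" for S
    proof
      assume "card S = 2 ^ d"
      moreover have "finite S" using S finite_F2 finite_subset by blast
      ultimately have "V2.dim S = d" using dim_eq_iff_card[OF S(1)] by blast
      then have "critical_number M \<le> t"
        using S n by (intro critical_number_le[of S]) auto
      then show False using M(4) by simp
    qed
    show "\<exists>S. V2.subspace S \<and> S \<subseteq> A \<and> card S = 2 ^ d"
      if W: "V2.subspace W" "W \<subseteq> ?V" "2 * card W = card ?V"
        and A: "A \<subseteq> W" "0 \<in> A" "card A < 3 * 2 ^ d"
          "\<And>T. V2.subspace T \<Longrightarrow> T \<subseteq> W \<Longrightarrow> card T = 2 ^ (t - 1) \<Longrightarrow> T \<inter> A \<noteq> {0}"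
      for W A
    proof -
      have finW: "finite W" using W(2) finite_F2 finite_subset by blast
      have "(2::nat) ^ (d + t) = 2 * 2 ^ (d + (t - 1))" using assms(1) by (cases t) auto
      moreover have "2 * card W = 2 ^ (d + t)" using W(3) n by simp
      ultimately have cW: "card W = 2 ^ (d + (t - 1))" by linarith
      have bound: "critical_number M' \<le> t - 1"
        if "simple_binary_matroid M'" "free_of (proj_geom (t - 1)) M'"
          "real (card (elts M')) > (1 - 3 / 2 ^ (t - 1)) * 2 ^ rk M'" for M'
        using assms(2)[OF that] assms(1) by auto
      have "t - 1 \<ge> 3" using assms(1) by simp
      then obtain S where "V2.subspace S" "S \<subseteq> A" "card S = 2 ^ d"
        by (rule critical_number_bound_transfer[OF _ bound W(1) finW cW A])
      then show ?thesis by blast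
    qed
  qed
  show False by (rule inconsistent)
qed

end
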